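(* For every integer $n\geq 1$, the circulant graph $C_{18n-3}(1,6n)$ is edge-betweenness-uniform; that is, $B'(e)$ takes the same value for all edges $e$ of $C_{18n-3}(1,6n)$.
   Context: For a positive integer $k$ and a list $L$ of positive integers, the circulant graph $C_k(L)$ is the simple undirected graph with vertices $v_1,\dots,v_k$ (indices taken modulo $k$) in which each $v_i$ is adjacent to $v_{i+j}$ and $v_{i-j}$ (indices mod $k$) for each $j\in L$. For an edge $e$ of a graph $G$, the edge betweenness centrality is $B'_G(e)=\sum_{x,y}\frac{\sigma_{xy}(e)}{\sigma_{xy}}$, written $B'(e)$ when $G$ is clear, where the sum is over all ordered pairs $(x,y)$ of distinct vertices, $\sigma_{xy}$ is the number of shortest paths between $x$ and $y$, and $\sigma_{xy}(e)$ is the number of those shortest paths that contain $e$. A graph $G$ is edge-betweenness-uniform (has uniform edge betweenness centrality) if $B'_G(e)$ has the same value for all edges $e$ of $G$. *)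

theory Defs
  imports Complex_Main "HOL-Number_Theory.Cong"
begin

text \<open>
  Simple undirected graphs; edges are two-element sets of vertices.
\<close>

record 'a ugraph =
  verts :: "'a set"
  edges :: "'a set set"

text \<open>
  The vertex \<open>v\<^sub>i\<close> is represented by its index \<open>i\<close>, taken in \<open>{1..k}\<close>. The condition
  \<open>u \<noteq> v\<close> keeps the graph simple when some \<open>j\<close> in the list is divisible by \<open>k\<close>.
\<close>

definition circulant :: "nat \<Rightarrow> nat list \<Rightarrow> int ugraph" where
  "circulant k L =
     \<lparr> verts = {1..int k},
       edges = {{u, v} | u v. u \<in> {1..int k} \<and> v \<in> {1..int k} \<and> u \<noteq> v \<and>
                  (\<exists>j\<in>set L. [v = u + int j] (mod int k) \<or> [v = u - int j] (mod int k))} \<rparr>"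

text \<open>
  A path is given by its sequence of vertices, so it has one edge less than the length
  of the list.
\<close>

definition is_path :: "'a ugraph \<Rightarrow> 'a \<Rightarrow> 'a list \<Rightarrow> 'a \<Rightarrow> bool" where
  "is_path G x p y \<longleftrightarrow>
     p \<noteq> [] \<and> hd p = x \<and> last p = y \<and> distinct p \<and> set p \<subseteq> verts G \<and>
     successively (\<lambda>u v. {u, v} \<in> edges G) p"

definition path_edges :: "'a list \<Rightarrow> 'a set set" where
  "path_edges p = {{p ! i, p ! Suc i} | i. Suc i < length p}"

definition shortest_paths :: "'a ugraph \<Rightarrow> 'a \<Rightarrow> 'a \<Rightarrow> 'a list set" where
  "shortest_paths G x y =
     {p. is_path G x p y \<and> (\<forall>q. is_path G x q y \<longrightarrow> length p \<le> length q)}"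

definition num_shortest_paths :: "'a ugraph \<Rightarrow> 'a \<Rightarrow> 'a \<Rightarrow> nat" where
  "num_shortest_paths G x y = card (shortest_paths G x y)"

definition num_shortest_paths_through :: "'a ugraph \<Rightarrow> 'a set \<Rightarrow> 'a \<Rightarrow> 'a \<Rightarrow> nat" where
  "num_shortest_paths_through G e x y = card {p \<in> shortest_paths G x y. e \<in> path_edges p}"

text \<open>
  Pairs of vertices in different components contribute \<open>0 / 0 = 0\<close>.
\<close>

definition edge_betweenness :: "'a ugraph \<Rightarrow> 'a set \<Rightarrow> real" where
  "edge_betweenness G e =
     (\<Sum>(x, y) \<in> {(x, y). x \<in> verts G \<and> y \<in> verts G \<and> x \<noteq> y}.
        real (num_shortest_paths_through G e x y) / real (num_shortest_paths G x y))"

definition edge_betweenness_uniform :: "'a ugraph \<Rightarrow> bool" where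
  "edge_betweenness_uniform G \<longleftrightarrow>
     (\<forall>e \<in> edges G. \<forall>f \<in> edges G. edge_betweenness G e = edge_betweenness G f)"

end

theory Submission imports Defs begin

text \<open>
  Put \<open>N = 6n - 1\<close>, so that the number of vertices is \<open>3N\<close>. As \<open>3\<close> and \<open>N\<close> are coprime,
  \<open>\<int>/3N\<close> is \<open>\<int>/3 \<times> \<int>/N\<close>, and the generators \<open>1\<close> and \<open>6n\<close> become \<open>(1, 1)\<close> and \<open>(0, 1)\<close>.
  Writing the second coordinate as \<open>j\<close> with \<open>\<bar>j\<bar> \<le> (N - 1) / 2\<close>, the involution
  \<open>(r, j) \<mapsto> (j - r, j)\<close> exchanges the two kinds of edges, except for the edges where \<open>j\<close> wraps
  around. The latter join vertices at the same distance from the origin, hence lie on no shortest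
  path from it, and so the involution maps shortest paths from the origin to shortest paths,
  exchanging the kinds of edges. Together with the translations, which act transitively on the
  edges of each kind, this makes the betweenness of the two kinds equal.
\<close>

section \<open>Walks along which a level function rises by at most one per step\<close>

text \<open>A walk has one step less than it has vertices, and each step gains at most one level;
  hence the strict inequality.\<close>

lemma last_level_less:
  fixes d :: "'a \<Rightarrow> nat"
  assumes "\<And>u v. P u v \<Longrightarrow> d v \<le> Suc (d u)" "successively P p" "p \<noteq> []"
  shows "d (last p) < d (hd p) + length p"
  using assms(2,3)
proof (induction p rule: induct_list012)
  case (3 u v p)
  then show ?case using assms(1)[of u v] by simp
qed auto

text \<open>The equality case of \<open>last_level_less\<close>: there is no slack, so every single
  step has to gain exactly one level.\<close>

lemma successively_level_Suc:
  fixes d :: "'a \<Rightarrow> nat"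
  assumes lip: "\<And>u v. P u v \<Longrightarrow> d v \<le> Suc (d u)" and "successively P p" "p \<noteq> []"
    and "d (hd p) + length p \<le> Suc (d (last p))"
  shows "successively (\<lambda>u v. P u v \<and> d v = Suc (d u)) p"
  using assms(2-4)
proof (induction p rule: induct_list012)
  case (3 u v p)
  have "d (last (v # p)) < d v + length (v # p)"
    using last_level_less[of P d "v # p"] lip 3 by auto
  moreover have "d v \<le> Suc (d u)" using lip 3 by auto
  ultimately show ?case using 3 by auto
qed auto

text \<open>Levels strictly increase along such a walk, so no vertex repeats. The lower bound on all
  levels is what the induction needs to keep the first vertex off the rest of the walk.\<close>

lemma level_Suc_walk:
  fixes d :: "'a \<Rightarrow> nat"
  assumes "successively (\<lambda>u v. P u v \<and> d v = Suc (d u)) p" "p \<noteq> []"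
  shows "d (hd p) + length p = Suc (d (last p)) \<and> distinct p \<and> (\<forall>u\<in>set p. d (hd p) \<le> d u)"
  using assms
proof (induction p rule: induct_list012)
  case (3 u v p)
  then show ?case by fastforce
qed auto

lemma path_edges_map: "path_edges (map f p) = (`) f ` path_edges p"
proof
  show "path_edges (map f p) \<subseteq> (`) f ` path_edges p"
  proof
    fix e assume "e \<in> path_edges (map f p)"
    then obtain i where "Suc i < length p" "e = f ` {p ! i, p ! Suc i}"
      by (auto simp: path_edges_def)
    moreover from this have "{p ! i, p ! Suc i} \<in> path_edges p" by (auto simp: path_edges_def)
    ultimately show "e \<in> (`) f ` path_edges p" by blast
  qed
  show "(`) f ` path_edges p \<subseteq> path_edges (map f p)"
  proof
    fix e assume "e \<in> (`) f ` path_edges p"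
    then obtain i where i: "Suc i < length p" "e = f ` {p ! i, p ! Suc i}"
      by (auto simp: path_edges_def)
    then have "e = {map f p ! i, map f p ! Suc i}" by simp
    moreover have "Suc i < length (map f p)" using i by simp
    ultimately show "e \<in> path_edges (map f p)" unfolding path_edges_def by blast
  qed
qed

lemma path_edges_subset: "e \<in> path_edges p \<Longrightarrow> e \<subseteq> set p"
  by (auto simp: path_edges_def)

lemma path_edges_successively:
  assumes "successively P p" "e \<in> path_edges p"
  shows "\<exists>u v. e = {u, v} \<and> P u v"
  using assms by (auto simp: path_edges_def successively_conv_nth)

section \<open>Graphs with a locally certified distance function\<close>

text \<open>The conditions on \<open>d x\<close> force it to be the graph distance from
  \<open>x\<close> on the vertices, and the graph to be connected. They are local, so an explicit
  formula for the distance can be verified edge by edge.\<close>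

locale levelled_graph =
  fixes G :: "'a ugraph" and d :: "'a \<Rightarrow> 'a \<Rightarrow> nat"
  assumes finite_verts: "finite (verts G)"
    and level_eq_0: "\<And>x u. x \<in> verts G \<Longrightarrow> u \<in> verts G \<Longrightarrow> d x u = 0 \<longleftrightarrow> u = x"
    and level_le: "\<And>x u v. {u, v} \<in> edges G \<Longrightarrow> d x v \<le> Suc (d x u)"
    and level_descent: "\<And>x u. x \<in> verts G \<Longrightarrow> u \<in> verts G \<Longrightarrow> u \<noteq> x \<Longrightarrow>
      \<exists>v\<in>verts G. {v, u} \<in> edges G \<and> d x u = Suc (d x v)"
begin

text \<open>These are the edges, directed away from \<open>x\<close>, of which the shortest paths
  from \<open>x\<close> consist.\<close>

definition up :: "'a \<Rightarrow> 'a \<Rightarrow> 'a \<Rightarrow> bool" where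
  "up x u v \<longleftrightarrow> {u, v} \<in> edges G \<and> d x v = Suc (d x u)"

text \<open>Descend from \<open>y\<close> one level at a time; only \<open>x\<close> has level 0, so
  the descent ends there. Read backwards it is the walk.\<close>

lemma ex_up_walk:
  assumes "x \<in> verts G" "y \<in> verts G"
  shows "\<exists>p. p \<noteq> [] \<and> hd p = x \<and> last p = y \<and> set p \<subseteq> verts G \<and> successively (up x) p"
  using assms(2)
proof (induction "d x y" arbitrary: y rule: less_induct)
  case less
  show ?case
  proof (cases "y = x")
    case True
    then show ?thesis using less by (intro exI[of _ "[x]"]) auto
  next
    case False
    then obtain v where v: "v \<in> verts G" "{v, y} \<in> edges G" "d x y = Suc (d x v)"
      using level_descent assms(1) less by blast
    then obtain p where p: "p \<noteq> []" "hd p = x" "last p = v" "set p \<subseteq> verts G"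
        "successively (up x) p"
      using less(1)[of v] by auto
    then show ?thesis using v less(2)
      by (intro exI[of _ "p @ [y]"]) (auto simp: successively_append_iff up_def)
  qed
qed

lemma up_walk:
  assumes "successively (up x) p" "p \<noteq> []" "hd p = x" "x \<in> verts G"
  shows "length p = Suc (d x (last p))" "distinct p" "successively (\<lambda>u v. {u, v} \<in> edges G) p"
proof -
  have "d x x = 0" using level_eq_0 assms(4) by blast
  with level_Suc_walk[of "\<lambda>u v. {u, v} \<in> edges G" "d x" p] assms
  show "length p = Suc (d x (last p))" "distinct p" by (auto simp: up_def)
  show "successively (\<lambda>u v. {u, v} \<in> edges G) p"
    using assms(1) by (rule successively_mono) (auto simp: up_def)
qed

text \<open>Every path to \<open>y\<close> has at least \<open>Suc (d x y)\<close> vertices, walks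
  along \<open>up x\<close> attain this bound, and attaining it forces every step to be
  \<open>up x\<close>. Minimality thus becomes a condition on single steps, which maps of the
  vertices can transport.\<close>

lemma shortest_paths_iff:
  assumes x: "x \<in> verts G" and y: "y \<in> verts G"
  shows "p \<in> shortest_paths G x y \<longleftrightarrow>
    p \<noteq> [] \<and> hd p = x \<and> last p = y \<and> set p \<subseteq> verts G \<and> successively (up x) p"
    (is "_ \<longleftrightarrow> ?R p")
proof -
  have d0: "d x x = 0" using level_eq_0 x by blast
  have long: "Suc (d x y) \<le> length q" if "is_path G x q y" for q
    using that last_level_less[of "\<lambda>u v. {u, v} \<in> edges G" "d x" q] level_le d0
    by (auto simp: is_path_def)
  have walk: "is_path G x q y \<and> length q = Suc (d x y)" if "?R q" for q
    using that up_walk[of x q] x by (auto simp: is_path_def)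
  obtain q where q: "?R q" using ex_up_walk x y by blast
  show ?thesis
  proof
    assume p: "p \<in> shortest_paths G x y"
    then have path: "is_path G x p y" and "length p \<le> Suc (d x y)"
      using walk[OF q] by (auto simp: shortest_paths_def)
    with successively_level_Suc[of "\<lambda>u v. {u, v} \<in> edges G" "d x" p] level_le d0
    show "?R p" by (auto simp: is_path_def up_def[abs_def])
  next
    assume "?R p"
    then show "p \<in> shortest_paths G x y"
      using walk[of p] long by (auto simp: shortest_paths_def)
  qed
qed

text \<open>Used in contraposition: an edge inside one level from \<open>x\<close> contributes
  nothing for the source \<open>x\<close>.\<close>

lemma through_imp_up:
  assumes "x \<in> verts G" "y \<in> verts G" "num_shortest_paths_through G {u, v} x y \<noteq> 0"
  shows "up x u v \<or> up x v u"
proof -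
  obtain p where "p \<in> shortest_paths G x y" "{u, v} \<in> path_edges p"
    using assms(3) unfolding num_shortest_paths_through_def
    by (metis (mono_tags, lifting) card.empty empty_Collect_eq)
  then show ?thesis
    using path_edges_successively[of "up x" p "{u, v}"] shortest_paths_iff assms
    by (auto simp: doubleton_eq_iff)
qed

section \<open>Transport of shortest paths and of betweenness along maps of the vertices\<close>

text \<open>The map \<open>f\<close> need not be an automorphism of the graph: only the edges that occur on
  shortest paths from \<open>x\<close> have to be respected.\<close>

lemma transport:
  assumes f: "bij_betw f (verts G) (verts G)" and x: "x \<in> verts G" and y: "y \<in> verts G"
    and up: "\<And>u v. u \<in> verts G \<Longrightarrow> v \<in> verts G \<Longrightarrow> up (f x) (f u) (f v) \<longleftrightarrow> up x u v"
  shows "num_shortest_paths G (f x) (f y) = num_shortest_paths G x y"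
    and "e \<subseteq> verts G \<Longrightarrow>
      num_shortest_paths_through G (f ` e) (f x) (f y) = num_shortest_paths_through G e x y"
proof -
  have inj: "inj_on f (verts G)" and img: "f ` verts G = verts G"
    using f by (auto simp: bij_betw_def)
  have fv: "f u \<in> verts G" if "u \<in> verts G" for u using img that by blast
  have inj_map: "inj_on (map f) {p. set p \<subseteq> verts G}"
  proof (rule inj_onI)
    fix p q assume "p \<in> {p. set p \<subseteq> verts G}" "q \<in> {p. set p \<subseteq> verts G}" "map f p = map f q"
    then show "p = q" using inj_on_subset[OF inj, of "set p \<union> set q"] inj_on_map_eq_map by blast
  qed
  have sub: "set p \<subseteq> verts G" if "p \<in> shortest_paths G x y" for p
    using that by (auto simp: shortest_paths_def is_path_def)
  have iff: "map f p \<in> shortest_paths G (f x) (f y) \<longleftrightarrow> p \<in> shortest_paths G x y"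
    if p: "set p \<subseteq> verts G" for p
  proof (cases "p = []")
    case False
    have "hd p \<in> verts G" "last p \<in> verts G" using p False by auto
    then have "f (hd p) = f x \<longleftrightarrow> hd p = x" "f (last p) = f y \<longleftrightarrow> last p = y"
      using x y inj by (auto dest: inj_onD)
    moreover have "successively (up (f x)) (map f p) \<longleftrightarrow> successively (up x) p"
      unfolding successively_map using p up by (intro successively_cong) auto
    moreover have "set (map f p) \<subseteq> verts G" using p fv by auto
    ultimately show ?thesis
      using p False x y fv by (simp add: shortest_paths_iff hd_map last_map)
  qed (use x y fv in \<open>simp add: shortest_paths_iff\<close>)
  have onto: "\<exists>p. q = map f p \<and> p \<in> shortest_paths G x y"
    if q: "q \<in> shortest_paths G (f x) (f y)" for q
  proof -
    have "q \<in> lists (f ` verts G)"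
      using q img by (auto simp: shortest_paths_def is_path_def)
    then obtain p where "q = map f p" "p \<in> lists (verts G)" unfolding lists_image by blast
    moreover from this have "set p \<subseteq> verts G" by auto
    ultimately show ?thesis using iff q by blast
  qed
  have SP: "shortest_paths G (f x) (f y) = map f ` shortest_paths G x y"
    using onto iff sub by blast
  show "num_shortest_paths G (f x) (f y) = num_shortest_paths G x y"
    unfolding num_shortest_paths_def SP
    by (rule card_image, rule inj_on_subset[OF inj_map]) (use sub in auto)
  assume e: "e \<subseteq> verts G"
  \<comment> \<open>Both \<open>e\<close> and the edges of \<open>p\<close> are sets of vertices,
    where \<open>f\<close> is injective, so equal images mean equal edges.\<close>
  have pe: "f ` e \<in> path_edges (map f p) \<longleftrightarrow> e \<in> path_edges p" if "p \<in> shortest_paths G x y" for p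
    using sub[OF that] path_edges_subset[of _ p] e inj_on_image_eq_iff[OF inj, of e]
    unfolding path_edges_map by (metis (no_types, lifting) image_iff subset_trans)
  have "{q \<in> shortest_paths G (f x) (f y). f ` e \<in> path_edges q} =
      map f ` {p \<in> shortest_paths G x y. e \<in> path_edges p}"
    unfolding SP using pe by auto
  then show "num_shortest_paths_through G (f ` e) (f x) (f y) = num_shortest_paths_through G e x y"
    unfolding num_shortest_paths_through_def
    by simp (rule card_image, rule inj_on_subset[OF inj_map], use sub in auto)
qed

text \<open>The map respects levels from all sources at once, so reindexing by
  \<open>(f x, f y)\<close> matches the summands one by one. This serves for the
  translations.\<close>

lemma edge_betweenness_invariant:
  assumes f: "bij_betw f (verts G) (verts G)" and e: "e \<subseteq> verts G"
    and edge: "\<And>u v. u \<in> verts G \<Longrightarrow> v \<in> verts G \<Longrightarrow> {f u, f v} \<in> edges G \<longleftrightarrow> {u, v} \<in> edges G"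
    and level: "\<And>x u. x \<in> verts G \<Longrightarrow> u \<in> verts G \<Longrightarrow> d (f x) (f u) = d x u"
  shows "edge_betweenness G (f ` e) = edge_betweenness G e"
proof -
  let ?P = "{(x, y). x \<in> verts G \<and> y \<in> verts G \<and> x \<noteq> y}"
  have "inj_on f (verts G)" and img: "f ` verts G = verts G"
    using f by (auto simp: bij_betw_def)
  then have inj: "f u = f v \<longleftrightarrow> u = v" if "u \<in> verts G" "v \<in> verts G" for u v
    using that by (auto dest: inj_onD)
  have fv: "f u \<in> verts G" if "u \<in> verts G" for u using img that by blast
  have "bij_betw (map_prod f f) ?P ?P"
    unfolding bij_betw_def
  proof
    show "inj_on (map_prod f f) ?P" by (auto simp: inj_on_def inj)
    have "(u, v) \<in> map_prod f f ` ?P" if "u \<in> f ` verts G" "v \<in> f ` verts G" "u \<noteq> v" for u v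
      using that by force
    then show "map_prod f f ` ?P = ?P" unfolding img using fv inj by auto
  qed
  moreover have up: "up (f x) (f u) (f v) \<longleftrightarrow> up x u v"
    if "x \<in> verts G" "u \<in> verts G" "v \<in> verts G" for x u v
    using that edge level by (auto simp: up_def)
  ultimately show ?thesis
    using transport[OF f _ _ up] e unfolding edge_betweenness_def
    by (subst sum.reindex_bij_betw[symmetric, of "map_prod f f" ?P ?P]) (auto intro!: sum.cong)
qed

text \<open>Here \<open>a\<close> and \<open>b\<close> generate the two kinds of edges, and
  \<open>s x\<close> is an involution centred at \<open>x\<close> that exchanges them wherever the
  level from \<open>x\<close> changes. The image of an edge varies with the source \<open>x\<close>,
  so only the sums over all edges of a kind are compared.\<close>

lemma sum_edge_betweenness_swap:
  assumes maps: "\<And>u. u \<in> verts G \<Longrightarrow> a u \<in> verts G" "\<And>u. u \<in> verts G \<Longrightarrow> b u \<in> verts G"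
    and edges: "edges G = {{u, a u} |u. u \<in> verts G} \<union> {{u, b u} |u. u \<in> verts G}"
    and s_vert: "\<And>x u. x \<in> verts G \<Longrightarrow> u \<in> verts G \<Longrightarrow> s x u \<in> verts G"
    and s_s: "\<And>x u. x \<in> verts G \<Longrightarrow> u \<in> verts G \<Longrightarrow> s x (s x u) = u"
    and level: "\<And>x u. x \<in> verts G \<Longrightarrow> u \<in> verts G \<Longrightarrow> d x (s x u) = d x u"
    and s_a: "\<And>x u. x \<in> verts G \<Longrightarrow> u \<in> verts G \<Longrightarrow> d x (a u) \<noteq> d x u \<Longrightarrow> s x (a u) = b (s x u)"
    and s_b: "\<And>x u. x \<in> verts G \<Longrightarrow> u \<in> verts G \<Longrightarrow> d x (b u) \<noteq> d x u \<Longrightarrow> s x (b u) = a (s x u)"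
  shows "(\<Sum>u\<in>verts G. edge_betweenness G {u, a u}) = (\<Sum>u\<in>verts G. edge_betweenness G {u, b u})"
proof -
  let ?V = "verts G"
  let ?P = "{(x, y). x \<in> ?V \<and> y \<in> ?V \<and> x \<noteq> y}"
  let ?t = "\<lambda>e x y. real (num_shortest_paths_through G e x y) / real (num_shortest_paths G x y)"
  \<comment> \<open>Only \<open>x\<close> itself has level 0 from \<open>x\<close>.\<close>
  have fixed: "s x x = x" if "x \<in> ?V" for x
    using level[OF that that] level_eq_0 that s_vert by metis
  have bij: "bij_betw (s x) ?V ?V" if "x \<in> ?V" for x
    by (rule bij_betw_byWitness[where f' = "s x"]) (use that s_vert s_s in auto)
  \<comment> \<open>An \<open>up\<close> edge is of one of the two kinds, based at either endpoint
    \<open>w\<close>, and changes the level; so \<open>s_a\<close> or \<open>s_b\<close> applies and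
    yields an edge of the other kind.\<close>
  have up1: "up x (s x u) (s x v)" if xuv: "x \<in> ?V" "u \<in> ?V" "v \<in> ?V" and "up x u v" for x u v
  proof -
    have d: "d x v = Suc (d x u)" and "{u, v} \<in> edges G" using that by (auto simp: up_def)
    then consider w where "w \<in> ?V" "{u, v} = {w, a w}" | w where "w \<in> ?V" "{u, v} = {w, b w}"
      unfolding edges by blast
    then have "{s x u, s x v} \<in> edges G"
    proof cases
      case 1
      then have "s x (a w) = b (s x w)" using d s_a[OF xuv(1), of w] by (auto simp: doubleton_eq_iff)
      moreover have "s x ` {u, v} = s x ` {w, a w}" using 1 by (simp only:)
      ultimately have "{s x u, s x v} = {s x w, b (s x w)}" by simp
      then show ?thesis unfolding edges using s_vert xuv 1 by blast
    next
      case 2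
      then have "s x (b w) = a (s x w)" using d s_b[OF xuv(1), of w] by (auto simp: doubleton_eq_iff)
      moreover have "s x ` {u, v} = s x ` {w, b w}" using 2 by (simp only:)
      ultimately have "{s x u, s x v} = {s x w, a (s x w)}" by simp
      then show ?thesis unfolding edges using s_vert xuv 2 by blast
    qed
    then show ?thesis using d level xuv by (simp add: up_def)
  qed
  \<comment> \<open>The converse is \<open>up1\<close> for the images, as \<open>s x\<close> is an
    involution.\<close>
  have up: "up (s x x) (s x u) (s x v) \<longleftrightarrow> up x u v" if "x \<in> ?V" "u \<in> ?V" "v \<in> ?V" for x u v
    using up1[of x u v] up1[of x "s x u" "s x v"] that s_s s_vert fixed by auto
  have through: "num_shortest_paths_through G {s x u, b (s x u)} x (s x y) =
      num_shortest_paths_through G {u, a u} x y"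
    if "x \<in> ?V" "y \<in> ?V" "u \<in> ?V" for x y u
  proof (cases "d x (a u) = d x u")
    case False
    then have "s x ` {u, a u} = {s x u, b (s x u)}" using s_a that by auto
    then show ?thesis
      using transport(2)[of "s x" x y "{u, a u}", OF bij _ _ up] that maps fixed by auto
  next
    case True
    \<comment> \<open>If the image edge joined two levels, \<open>s_b\<close> would carry it back to
      \<open>{u, a u}\<close>, whose endpoints share a level. So both edges stay inside a level and
      both counts vanish.\<close>
    have "d x (b (s x u)) = d x (s x u)"
    proof (rule ccontr)
      assume ne: "d x (b (s x u)) \<noteq> d x (s x u)"
      then have "s x (b (s x u)) = a u" using s_b[of x "s x u"] s_s s_vert that by simp
      then show False using ne True level[of x "b (s x u)"] level[of x u] that maps s_vert by simp
    qed
    then have "num_shortest_paths_through G {s x u, b (s x u)} x (s x y) = 0"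
      using through_imp_up[of x "s x y" "s x u" "b (s x u)"] that s_vert
      by (metis up_def n_not_Suc_n)
    moreover have "num_shortest_paths_through G {u, a u} x y = 0"
      using True through_imp_up[of x y u "a u"] that by (metis up_def n_not_Suc_n)
    ultimately show ?thesis by simp
  qed
  have inner: "(\<Sum>u\<in>?V. ?t {u, a u} x y) = (\<Sum>u\<in>?V. ?t {u, b u} x (s x y))"
    if xy: "x \<in> ?V" "y \<in> ?V" for x y
  proof -
    have "(\<Sum>u\<in>?V. ?t {u, b u} x (s x y)) = (\<Sum>u\<in>?V. ?t {s x u, b (s x u)} x (s x y))"
      by (rule sum.reindex_bij_betw[OF bij[OF xy(1)], symmetric])
    also have "\<dots> = (\<Sum>u\<in>?V. ?t {u, a u} x y)"
      using through transport(1)[of "s x" x y, OF bij _ _ up] xy fixed by (intro sum.cong) auto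
    finally show ?thesis by simp
  qed
  \<comment> \<open>Since \<open>s x\<close> fixes \<open>x\<close> and is injective,
    \<open>s x y\<close> differs from \<open>x\<close> whenever \<open>y\<close> does.\<close>
  have bijP: "bij_betw (\<lambda>(x, y). (x, s x y)) ?P ?P"
    by (rule bij_betw_byWitness[where f' = "\<lambda>(x, y). (x, s x y)"])
      (use s_vert s_s fixed in \<open>auto, (metis fixed s_s)+\<close>)
  have "(\<Sum>u\<in>?V. edge_betweenness G {u, a u}) = (\<Sum>(x, y)\<in>?P. \<Sum>u\<in>?V. ?t {u, a u} x y)"
    unfolding edge_betweenness_def by (subst sum.swap) (simp add: case_prod_unfold)
  also have "\<dots> = (\<Sum>(x, y)\<in>?P. \<Sum>u\<in>?V. ?t {u, b u} x (s x y))"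
    using inner by (intro sum.cong) auto
  also have "\<dots> = (\<Sum>(x, y)\<in>?P. \<Sum>u\<in>?V. ?t {u, b u} x y)"
    using sum.reindex_bij_betw[OF bijP, of "\<lambda>(x, y). \<Sum>u\<in>?V. ?t {u, b u} x y"]
    by (simp add: case_prod_unfold)
  also have "\<dots> = (\<Sum>u\<in>?V. edge_betweenness G {u, b u})"
    unfolding edge_betweenness_def by (subst sum.swap) (simp add: case_prod_unfold)
  finally show ?thesis .
qed

end

section \<open>An explicit distance function on the integers modulo
  \<open>18 * n - 3\<close>\<close>

text \<open>The coordinate \<open>j\<close>, for an integer representative \<open>z\<close>. The other coordinate is only used
  through \<open>z + j\<close> modulo \<open>3\<close>, which the involution negates.\<close>

definition row :: "int \<Rightarrow> int \<Rightarrow> int" where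
  "row n z = (z + (3 * n - 1)) mod (6 * n - 1) - (3 * n - 1)"

text \<open>\<open>t\<close> says that \<open>z + j\<close> is 0 modulo 3. Away from the
  wrap-around, a step changes \<open>j\<close> by one and \<open>z + j\<close> by a nonzero residue
  of free choice. Two or more steps in one direction thus reach all residues, and one step only the
  nonzero ones. In row 0 a nonzero residue costs a step and a step back; in rows 1 and -1 residue 0
  costs three steps.\<close>

definition dist0 :: "int \<Rightarrow> bool \<Rightarrow> nat" where
  "dist0 j t =
     (if \<bar>j\<bar> \<ge> 2 then nat \<bar>j\<bar> else if j = 0 then (if t then 0 else 2) else (if t then 3 else 1))"

text \<open>The distance from the origin.\<close>

definition level :: "int \<Rightarrow> int \<Rightarrow> nat" where
  "level n z = dist0 (row n z) (3 dvd z + row n z)"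

text \<open>The involution \<open>(r, j) \<mapsto> (j - r, j)\<close>: congruent to \<open>z\<close> modulo \<open>6n - 1\<close> and to \<open>j - z\<close>
  modulo \<open>3\<close>.\<close>

definition twist :: "int \<Rightarrow> int \<Rightarrow> int" where
  "twist n z = z - (6 * n - 1) * (z + row n z)"

context
  fixes n :: int
  assumes n: "n \<ge> 1"
begin

lemma row_bounds: "1 - 3 * n \<le> row n z" "row n z \<le> 3 * n - 1"
proof -
  have "0 \<le> (z + (3 * n - 1)) mod (6 * n - 1)" "(z + (3 * n - 1)) mod (6 * n - 1) < 6 * n - 1"
    using n by (simp_all add: pos_mod_bound)
  then show "1 - 3 * n \<le> row n z" "row n z \<le> 3 * n - 1" by (simp_all add: row_def)
qed

lemma row_dvd: "6 * n - 1 dvd row n z - z"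
proof -
  have "row n z - z = - ((6 * n - 1) * ((z + (3 * n - 1)) div (6 * n - 1)))"
    using minus_mult_div_eq_mod[of "z + (3 * n - 1)" "6 * n - 1"] by (simp add: row_def)
  then show ?thesis by simp
qed

lemma row_eqI:
  assumes "1 - 3 * n \<le> j" "j \<le> 3 * n - 1" "6 * n - 1 dvd j - z"
  shows "row n z = j"
proof -
  have "6 * n - 1 dvd row n z - j" using dvd_diff[OF row_dvd[of z] assms(3)] by simp
  moreover have "\<bar>row n z - j\<bar> < 6 * n - 1" using assms row_bounds[of z] by linarith
  ultimately show ?thesis using dvd_imp_le_int[of "row n z - j" "6 * n - 1"] by auto
qed

lemma row_cong:
  assumes "6 * n - 1 dvd w - z"
  shows "row n w = row n z"
proof (rule row_eqI[OF row_bounds])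
  show "6 * n - 1 dvd row n z - w" using dvd_diff[OF row_dvd[of z] assms] by simp
qed

text \<open>As \<open>6 * n\<close> is 1 modulo \<open>6 * n - 1\<close>, both generators move by
  one row inside the window of representatives.\<close>

lemma row_step:
  "row n z < 3 * n - 1 \<Longrightarrow> row n (z + 1) = row n z + 1"
  "row n z < 3 * n - 1 \<Longrightarrow> row n (z + 6 * n) = row n z + 1"
  "1 - 3 * n < row n z \<Longrightarrow> row n (z - 1) = row n z - 1"
  "1 - 3 * n < row n z \<Longrightarrow> row n (z - 6 * n) = row n z - 1"
proof -
  have dvd: "6 * n - 1 dvd row n z - z + (6 * n - 1) * i" for i
    using row_dvd[of z] by simp
  show "row n (z + 1) = row n z + 1" if "row n z < 3 * n - 1"
    using that row_bounds[of z] dvd[of 0] by (intro row_eqI) auto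
  show "row n (z + 6 * n) = row n z + 1" if "row n z < 3 * n - 1"
    using that row_bounds[of z] dvd[of "-1"] by (intro row_eqI) (auto simp: algebra_simps)
  show "row n (z - 1) = row n z - 1" if "1 - 3 * n < row n z"
    using that row_bounds[of z] dvd[of 0] by (intro row_eqI) auto
  show "row n (z - 6 * n) = row n z - 1" if "1 - 3 * n < row n z"
    using that row_bounds[of z] dvd[of 1] by (intro row_eqI) (auto simp: algebra_simps)
qed

lemma row_wrap:
  assumes "row n z = 3 * n - 1"
  shows "row n (z + 1) = 1 - 3 * n" "row n (z + 6 * n) = 1 - 3 * n"
proof -
  have dvd: "6 * n - 1 dvd row n z - z + (6 * n - 1) * i" for i
    using row_dvd[of z] by simp
  have eq: "1 - 3 * n - (z + 1) = row n z - z + (6 * n - 1) * (- 1)"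
    "1 - 3 * n - (z + 6 * n) = row n z - z + (6 * n - 1) * (- 2)"
    using assms by simp_all
  have "6 * n - 1 dvd 1 - 3 * n - (z + 1)" "6 * n - 1 dvd 1 - 3 * n - (z + 6 * n)"
    unfolding eq by (rule dvd)+
  then show "row n (z + 1) = 1 - 3 * n" "row n (z + 6 * n) = 1 - 3 * n"
    using n by (auto intro: row_eqI)
qed

text \<open>The top and bottom rows have the same absolute value, which is at least 2 because
  \<open>n \<ge> 1\<close>; there \<open>dist0\<close> ignores the residue modulo 3.\<close>

lemma row_wrap_level:
  assumes "row n z = 3 * n - 1"
  shows "level n (z + 1) = level n z" "level n (z + 6 * n) = level n z"
  using n by (simp_all add: row_wrap[OF assms] assms level_def dist0_def)

text \<open>A step upwards adds 2 or 1 to \<open>z + row n z\<close> modulo 3, so residue 0 never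
  follows residue 0.\<close>

lemma not_dvd_step:
  assumes "t \<in> {1, 6 * n}" "3 dvd z + row n z"
  shows "\<not> 3 dvd z + t + (row n z + 1)"
proof -
  obtain c where "z + row n z = 3 * c" using assms by auto
  then have "z + 1 + (row n z + 1) = 3 * c + 2" "z + 6 * n + (row n z + 1) = 3 * (c + 2 * n) + 1"
    by auto
  then show ?thesis using assms(1) by auto presburger+
qed

lemma level_lipschitz:
  assumes "t \<in> {1, 6 * n}"
  shows "level n (z + t) \<le> Suc (level n z)" "level n z \<le> Suc (level n (z + t))"
proof -
  have "level n (z + t) \<le> Suc (level n z) \<and> level n z \<le> Suc (level n (z + t))"
  proof (cases "row n z = 3 * n - 1")
    case True
    then show ?thesis using row_wrap_level assms by auto
  next
    case False
    then have row: "row n (z + t) = row n z + 1"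
      using row_step row_bounds[of z] assms by fastforce
    \<comment> \<open>The excluded case contains the only bad jump: residue 0 in row 0 has value 0,
      but in rows 1 and -1 it has value 3.\<close>
    have "dist0 (j + 1) q \<le> Suc (dist0 j p) \<and> dist0 j p \<le> Suc (dist0 (j + 1) q)"
      if "\<not> (p \<and> q)" for j p q
      using that by (auto simp: dist0_def)
    then show ?thesis unfolding level_def row using not_dvd_step[OF assms] by blast
  qed
  then show "level n (z + t) \<le> Suc (level n z)" "level n z \<le> Suc (level n (z + t))" by auto
qed

lemma dvd_18_iff: "18 * n - 3 dvd z \<longleftrightarrow> 3 dvd z \<and> 6 * n - 1 dvd z"
proof -
  have "coprime 3 (6 * n - 1)"
  proof (rule coprimeI)
    fix c :: int assume "c dvd 3" "c dvd 6 * n - 1"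
    then have "c dvd 3 * (2 * n) - (6 * n - 1)" by (rule dvd_diff[OF dvd_mult2])
    then show "is_unit c" by simp
  qed
  moreover have "18 * n - 3 = 3 * (6 * n - 1)" by simp
  ultimately show ?thesis using divides_mult[of 3 z "6 * n - 1"]
    by (metis dvd_mult_left dvd_mult_right)
qed

lemma level_eq_0_iff: "level n z = 0 \<longleftrightarrow> 18 * n - 3 dvd z"
proof -
  have "row n z = 0 \<longleftrightarrow> 6 * n - 1 dvd z"
    using row_dvd[of z] row_eqI[of 0 z] n by auto
  moreover have "dist0 j p = 0 \<longleftrightarrow> j = 0 \<and> p" for j p by (auto simp: dist0_def)
  ultimately show ?thesis unfolding dvd_18_iff level_def by auto
qed

text \<open>In either direction the two generators shift \<open>z + row n z\<close> by the two
  nonzero residues modulo 3. At most one of them leads to residue 0, and exactly one does from a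
  nonzero residue.\<close>

lemma ex_step:
  "\<exists>t\<in>{1, 6 * n}. \<not> 3 dvd z + t + (row n z + 1)"
  "\<exists>t\<in>{1, 6 * n}. \<not> 3 dvd z - t + (row n z - 1)"
  "\<not> 3 dvd z + row n z \<Longrightarrow> \<exists>t\<in>{1, 6 * n}. 3 dvd z + t + (row n z + 1)"
  "\<not> 3 dvd z + row n z \<Longrightarrow> \<exists>t\<in>{1, 6 * n}. 3 dvd z - t + (row n z - 1)"
proof -
  define c where "c = z + row n z"
  have "z + 6 * n + (row n z + 1) = c + 1 + 2 * n * 3" "z - 6 * n + (row n z - 1) = c - 1 + (- 2 * n) * 3"
    by (simp_all add: c_def)
  then have *: "3 dvd z + 6 * n + (row n z + 1) \<longleftrightarrow> 3 dvd c + 1"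
      "3 dvd z - 6 * n + (row n z - 1) \<longleftrightarrow> 3 dvd c - 1"
    by (simp_all only: dvd_add_times_triv_right_iff)
  have **: "z + 1 + (row n z + 1) = c + 2" "z - 1 + (row n z - 1) = c - 2"
    by (simp_all add: c_def)
  have "\<not> 3 dvd c + 2 \<or> \<not> 3 dvd c + 1" by presburger
  then show "\<exists>t\<in>{1, 6 * n}. \<not> 3 dvd z + t + (row n z + 1)"
    by (auto simp only: * ** bex_simps)
  have "\<not> 3 dvd c - 2 \<or> \<not> 3 dvd c - 1" by presburger
  then show "\<exists>t\<in>{1, 6 * n}. \<not> 3 dvd z - t + (row n z - 1)"
    by (auto simp only: * ** bex_simps)
  have "3 dvd c + 2 \<or> 3 dvd c + 1" "3 dvd c - 2 \<or> 3 dvd c - 1" if "\<not> 3 dvd c"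
    using that by presburger+
  then show "\<exists>t\<in>{1, 6 * n}. 3 dvd z + t + (row n z + 1)"
    "\<exists>t\<in>{1, 6 * n}. 3 dvd z - t + (row n z - 1)" if "\<not> 3 dvd z + row n z"
    using that by (auto simp only: * ** bex_simps c_def[symmetric])
qed

text \<open>Step towards row 0, or from row 0 to row 1. From rows 1 and -1 with nonzero residue the
  generator is chosen to hit the origin; in all other cases it is chosen to reach a nonzero
  residue.\<close>

lemma level_descent:
  assumes "level n z \<noteq> 0"
  shows "\<exists>t\<in>{1, 6 * n}. level n z = Suc (level n (z + t)) \<or> level n z = Suc (level n (z - t))"
proof -
  \<comment> \<open>The row bounds exclude the wrap-around, since \<open>3 * n - 1\<close> is at
    least 2.\<close>
  have up: "level n (z + t) = dist0 (row n z + 1) (3 dvd z + t + (row n z + 1))"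
    if "row n z \<le> 1" "t \<in> {1, 6 * n}" for t
    using that row_step n unfolding level_def by auto
  have down: "level n (z - t) = dist0 (row n z - 1) (3 dvd z - t + (row n z - 1))"
    if "row n z > 0" "t \<in> {1, 6 * n}" for t
    using that row_step n unfolding level_def by auto
  let ?near = "\<bar>row n z\<bar> = 1 \<and> \<not> 3 dvd z + row n z"
  consider (pos) "row n z > 0" ?near | (pos') "row n z > 0" "\<not> ?near"
    | (neg) "row n z < 0" ?near | (neg') "row n z < 0" "\<not> ?near" | (zero) "row n z = 0"
    by linarith
  then show ?thesis
  proof cases
    case pos
    then obtain t where t: "t \<in> {1, 6 * n}" "3 dvd z - t + (row n z - 1)"
      using ex_step(4) by blast
    have "dist0 j False = Suc (dist0 (j - 1) True)" if "j > 0" "\<bar>j\<bar> = 1" for j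
      using that by (auto simp: dist0_def)
    then show ?thesis using down[OF pos(1) t(1)] t pos by (auto simp: level_def)
  next
    case pos'
    obtain t where t: "t \<in> {1, 6 * n}" "\<not> 3 dvd z - t + (row n z - 1)"
      using ex_step(2) by blast
    have "dist0 j p = Suc (dist0 (j - 1) False)" if "j > 0" "\<not> (\<bar>j\<bar> = 1 \<and> \<not> p)" for j p
      using that by (auto simp: dist0_def)
    then have "level n z = Suc (level n (z - t))"
      using down[OF pos'(1) t(1)] t pos' unfolding level_def by presburger
    then show ?thesis using t by blast
  next
    case neg
    then obtain t where t: "t \<in> {1, 6 * n}" "3 dvd z + t + (row n z + 1)"
      using ex_step(3) by blast
    have "dist0 j False = Suc (dist0 (j + 1) True)" if "j < 0" "\<bar>j\<bar> = 1" for j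
      using that by (auto simp: dist0_def)
    then have "level n z = Suc (level n (z + t))"
      using up[OF _ t(1)] t neg unfolding level_def by auto
    then show ?thesis using t by blast
  next
    case neg'
    obtain t where t: "t \<in> {1, 6 * n}" "\<not> 3 dvd z + t + (row n z + 1)"
      using ex_step(1) by blast
    have "dist0 j p = Suc (dist0 (j + 1) False)" if "j < 0" "\<not> (\<bar>j\<bar> = 1 \<and> \<not> p)" for j p
      using that by (auto simp: dist0_def)
    then have "level n z = Suc (level n (z + t))"
      using up[OF _ t(1)] t neg' unfolding level_def by auto
    then show ?thesis using t by blast
  next
    case zero
    obtain t where t: "t \<in> {1, 6 * n}" "\<not> 3 dvd z + t + (row n z + 1)"
      using ex_step(1) by blast
    have "dist0 0 p = Suc (dist0 (0 + 1) False)" if "dist0 0 p \<noteq> 0" for p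
      using that by (auto simp: dist0_def split: if_splits)
    then have "level n z = Suc (level n (z + t))"
      using up[OF _ t(1)] t zero assms unfolding level_def by auto
    then show ?thesis using t by blast
  qed
qed

lemma level_cong:
  assumes "18 * n - 3 dvd w - z"
  shows "level n w = level n z"
proof -
  have r: "row n w = row n z" and "3 dvd w - z" using assms row_cong dvd_18_iff by blast+
  then have "3 dvd w + row n w \<longleftrightarrow> 3 dvd z + row n z"
    using dvd_diff_commute by (metis add_diff_cancel_right dvd_diff_right_iff)
  then show ?thesis unfolding level_def r by simp
qed

section \<open>The involution and its effect on the two generators\<close>

lemma row_twist: "row n (twist n z) = row n z"
  by (rule row_cong) (simp add: twist_def)

text \<open>As \<open>6 * n - 1\<close> is -1 modulo 3, the involution negates
  \<open>z + row n z\<close> modulo 3, and it keeps the row.\<close>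

lemma level_twist: "level n (twist n z) = level n z"
proof -
  have "twist n z + row n z = (z + row n z) - (6 * n - 1) * (z + row n z)" by (simp add: twist_def)
  also have "\<dots> = 3 * (z + row n z - 2 * n * (z + row n z)) - (z + row n z)"
    by (simp add: algebra_simps)
  finally have "3 dvd twist n z + row n z \<longleftrightarrow> 3 dvd z + row n z"
    by (simp only: dvd_diff_right_iff[OF dvd_triv_left])
  then show ?thesis unfolding level_def row_twist by simp
qed

lemma twist_cong:
  assumes "18 * n - 3 dvd w - z"
  shows "18 * n - 3 dvd twist n w - twist n z"
proof -
  have "row n w = row n z" using assms row_cong dvd_18_iff by blast
  then have "twist n w - twist n z = (2 - 6 * n) * (w - z)" by (simp add: twist_def algebra_simps)
  then show ?thesis using assms by simp
qed

lemma twist_twist: "18 * n - 3 dvd twist n (twist n z) - z"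
proof -
  have "twist n (twist n z) - z = (18 * n - 3) * ((2 * n - 1) * (z + row n z))"
    unfolding twist_def[of n "twist n z"] row_twist by (simp add: twist_def algebra_simps)
  then show ?thesis by simp
qed

text \<open>A change of level rules out the wrap-around by \<open>row_wrap_level\<close>. So the row
  rises by one, \<open>z + row n z\<close> by 2, and the involution's value by
  \<open>1 - 2 * (6 * n - 1)\<close>, which is \<open>6 * n\<close> modulo
  \<open>18 * n - 3\<close>.\<close>

lemma twist_step:
  assumes "level n (z + 1) \<noteq> level n z"
  shows "18 * n - 3 dvd twist n (z + 1) - (twist n z + 6 * n)"
proof -
  have "row n (z + 1) = row n z + 1"
    using row_step(1)[of z] row_wrap_level(1)[of z] row_bounds(2)[of z] assms by fastforce
  then have "twist n (z + 1) - (twist n z + 6 * n) = (18 * n - 3) * (- 1)"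
    by (simp add: twist_def algebra_simps)
  then show ?thesis by (simp only: dvd_triv_left)
qed

lemma twist_step':
  assumes "level n (z + 6 * n) \<noteq> level n z"
  shows "18 * n - 3 dvd twist n (z + 6 * n) - (twist n z + 1)"
proof -
  have "row n (z + 6 * n) = row n z + 1"
    using row_step(2)[of z] row_wrap_level(2)[of z] row_bounds(2)[of z] assms by fastforce
  then have "twist n (z + 6 * n) - (twist n z + 1) = (18 * n - 3) * (- 2 * n)"
    by (simp add: twist_def algebra_simps)
  then show ?thesis by simp
qed

end

section \<open>Residues modulo \<open>k\<close> represented in \<open>{1..k}\<close>, and adjacency
  in circulant graphs\<close>

lemma dvd_diff_trans:
  fixes k :: int
  shows "k dvd a - b \<Longrightarrow> k dvd b - c \<Longrightarrow> k dvd a - c"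
  using dvd_add[of k "a - b" "b - c"] by simp

lemma dvd_diff_shift:
  fixes k :: int
  assumes "k dvd a - b"
  shows "k dvd a + s \<longleftrightarrow> k dvd b + s"
  using dvd_add_right_iff[OF assms, of "b + s"] by simp

definition wrap :: "int \<Rightarrow> int \<Rightarrow> int" where
  "wrap k c = (c - 1) mod k + 1"

lemma wrap_in: "k > 0 \<Longrightarrow> wrap k c \<in> {1..k}"
  using pos_mod_sign[of k "c - 1"] pos_mod_bound[of k "c - 1"] unfolding wrap_def atLeastAtMost_iff
  by linarith

lemma wrap_dvd: "k dvd wrap k c - c"
proof -
  have "wrap k c - c = - (k * ((c - 1) div k))"
    using minus_mult_div_eq_mod[of "c - 1" k] by (simp add: wrap_def)
  then show ?thesis by simp
qed

lemma dvd_imp_eq: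
  fixes k :: int
  assumes "u \<in> {1..k}" "v \<in> {1..k}" "k dvd u - v"
  shows "u = v"
proof (rule ccontr)
  assume "u \<noteq> v"
  then have "k \<le> \<bar>u - v\<bar>" using dvd_imp_le_int[of "u - v" k] assms by auto
  then show False using assms by auto
qed

lemma wrap_eqI:
  assumes "u \<in> {1..k}" "k dvd c - u"
  shows "wrap k c = u"
proof (rule dvd_imp_eq)
  show "wrap k c \<in> {1..k}" using assms by (intro wrap_in) auto
  show "k dvd wrap k c - u" by (rule dvd_diff_trans[OF wrap_dvd assms(2)])
qed (rule assms)

lemma circulant_edge_iff:
  assumes "u \<in> {1..int k}" "v \<in> {1..int k}"
  shows "{u, v} \<in> edges (circulant k L) \<longleftrightarrow>
    u \<noteq> v \<and> (\<exists>j\<in>set L. int k dvd v - u - int j \<or> int k dvd v - u + int j)"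
proof -
  have cong: "[b = a + int j] (mod int k) \<longleftrightarrow> int k dvd b - a - int j"
    "[b = a - int j] (mod int k) \<longleftrightarrow> int k dvd b - a + int j" for a b j
    by (simp_all add: cong_iff_dvd_diff algebra_simps)
  \<comment> \<open>Exchanging the endpoints of an unordered pair swaps the two congruences.\<close>
  have flip: "int k dvd u - v - int j \<longleftrightarrow> int k dvd v - u + int j"
    "int k dvd u - v + int j \<longleftrightarrow> int k dvd v - u - int j" for j
    by (subst dvd_minus_iff[symmetric], simp add: algebra_simps)+
  show ?thesis
    using assms unfolding circulant_def cong by (auto simp: doubleton_eq_iff flip)
qed

lemma edges_circulant_subset: "e \<in> edges (circulant k L) \<Longrightarrow> e \<subseteq> {1..int k}"
  by (auto simp: circulant_def)

section \<open>Application to the circulant graph with generators 1 and \<open>6 * n\<close>\<close>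

definition circ :: "nat \<Rightarrow> int ugraph" where
  "circ n = circulant (18 * n - 3) [1, 6 * n]"

context
  fixes n :: nat
  assumes n: "n \<ge> 1"
begin

abbreviation "k \<equiv> 18 * int n - 3"
abbreviation "C \<equiv> circ n"
abbreviation "dst x u \<equiv> level (int n) (u - x)"

lemma int_n: "int n \<ge> 1"
  using n by simp

lemma k_pos: "k > 0"
  using n by simp

lemma int_k: "int (18 * n - 3) = k"
  using n by simp

lemma verts_C: "verts C = {1..k}"
  by (simp add: circ_def circulant_def int_k)

lemma edge_iff:
  assumes "u \<in> {1..k}" "v \<in> {1..k}"
  shows "{u, v} \<in> edges C \<longleftrightarrow> (\<exists>t\<in>{1, 6 * int n}. k dvd v - u - t \<or> k dvd v - u + t)"
proof -
  \<comment> \<open>Both generators lie strictly between 0 and \<open>k\<close>, so \<open>k\<close>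
    divides neither.\<close>
  have "u \<noteq> v" if t: "t \<in> {1, 6 * int n}" "k dvd v - u - t \<or> k dvd v - u + t" for t
  proof
    assume "u = v"
    then have "k dvd t" using t(2) by simp
    then show False using zdvd_imp_le[of k t] t(1) n by auto
  qed
  moreover have "{u, v} \<in> edges C \<longleftrightarrow>
      u \<noteq> v \<and> (\<exists>t\<in>{1, 6 * int n}. k dvd v - u - t \<or> k dvd v - u + t)"
    using circulant_edge_iff[of u "18 * n - 3" v "[1, 6 * n]"] assms unfolding int_k circ_def by simp
  ultimately show ?thesis by blast
qed

lemma edge_in_verts: "{u, v} \<in> edges C \<Longrightarrow> u \<in> {1..k} \<and> v \<in> {1..k}"
  using edges_circulant_subset[of "{u, v}" "18 * n - 3"] unfolding int_k circ_def by blast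

lemma dst_edge_le:
  assumes "{u, v} \<in> edges C"
  shows "dst x v \<le> Suc (dst x u)"
proof -
  obtain t where t: "t \<in> {1, 6 * int n}" "k dvd v - u - t \<or> k dvd v - u + t"
    using assms edge_iff edge_in_verts by blast
  from t(2) show ?thesis
  proof
    assume "k dvd v - u - t"
    then have "dst x v = level (int n) (u - x + t)"
      by (intro level_cong[OF int_n]) (simp add: algebra_simps)
    then show ?thesis using level_lipschitz(1)[OF int_n t(1)] by simp
  next
    assume "k dvd v - u + t"
    then have "k dvd - (v - u + t)" by (simp only: dvd_minus_iff)
    then have "dst x u = level (int n) (v - x + t)"
      by (intro level_cong[OF int_n]) (simp add: algebra_simps)
    then show ?thesis using level_lipschitz(2)[OF int_n t(1)] by simp
  qed
qed

lemma dst_descent: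
  assumes "x \<in> {1..k}" "u \<in> {1..k}" "u \<noteq> x"
  shows "\<exists>v\<in>{1..k}. {v, u} \<in> edges C \<and> dst x u = Suc (dst x v)"
proof -
  have "dst x u \<noteq> 0" using level_eq_0_iff[OF int_n] dvd_imp_eq assms by blast
  then obtain t s where t: "t \<in> {1, 6 * int n}" and s: "s = t \<or> s = - t"
    and lev: "dst x u = Suc (level (int n) (u - x + s))"
    using level_descent[OF int_n, of "u - x"] by fastforce
  let ?v = "wrap k (u + s)"
  have v: "?v \<in> {1..k}" using wrap_in k_pos by blast
  have dvd: "k dvd ?v - (u + s)" by (rule wrap_dvd)
  then have "k dvd - (?v - (u + s))" by (simp only: dvd_minus_iff)
  then have "k dvd u - ?v + s" by (simp add: algebra_simps)
  then have "{?v, u} \<in> edges C" unfolding edge_iff[OF v assms(2)] using t s by auto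
  moreover have "dst x ?v = level (int n) (u - x + s)"
    using dvd by (intro level_cong[OF int_n]) (simp add: algebra_simps)
  ultimately show ?thesis using v lev by auto
qed

interpretation levelled_graph C "\<lambda>x u. dst x u"
proof
  show "finite (verts C)" by (simp add: verts_C)
  show "dst x u = 0 \<longleftrightarrow> u = x" if "x \<in> verts C" "u \<in> verts C" for x u
    using that level_eq_0_iff[OF int_n, of "u - x"] dvd_imp_eq[of u k x] by (auto simp: verts_C)
qed (use dst_edge_le dst_descent in \<open>auto simp: verts_C\<close>)

lemma wrap_wrap:
  assumes "k dvd (c + a) - (c' + a')"
  shows "wrap k (wrap k c + a) = wrap k (c' + a')"
proof (rule wrap_eqI)
  have "k dvd wrap k c + a - (c + a)" using wrap_dvd[of k c] by simp
  moreover have "k dvd (c' + a') - wrap k (c' + a')"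
    using wrap_dvd by (metis dvd_minus_iff minus_diff_eq)
  ultimately show "k dvd wrap k c + a - wrap k (c' + a')"
    using assms dvd_diff_trans by blast
qed (use wrap_in k_pos in blast)

text \<open>Translation by \<open>u - 1\<close> carries vertex 1 to \<open>u\<close> and preserves
  differences modulo \<open>k\<close>, hence adjacency and distances.\<close>

lemma edge_betweenness_translate:
  assumes "u \<in> {1..k}"
  shows "edge_betweenness C {u, wrap k (u + t)} = edge_betweenness C {1, wrap k (1 + t)}"
proof -
  let ?f = "\<lambda>v. wrap k (v + (u - 1))"
  have diff: "k dvd (?f v - ?f x) - (v - x)" for v x
    using dvd_diff[OF wrap_dvd[of k "v + (u - 1)"] wrap_dvd[of k "x + (u - 1)"]]
    by (simp add: algebra_simps)
  have inv: "wrap k (wrap k (v + a) + b) = v" if "v \<in> {1..k}" "b = - a" for v a b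
    by (rule wrap_eqI[OF that(1)]) (use wrap_dvd[of k "v + a"] that(2) in \<open>simp add: algebra_simps\<close>)
  have mem: "wrap k c \<in> {1..k}" for c by (rule wrap_in[OF k_pos])
  have bij: "bij_betw ?f (verts C) (verts C)"
    unfolding verts_C
  proof (rule bij_betw_byWitness[where f' = "\<lambda>v. wrap k (v + (1 - u))"])
    show "\<forall>v\<in>{1..k}. wrap k (?f v + (1 - u)) = v" by (rule ballI, rule inv) auto
    show "\<forall>v\<in>{1..k}. ?f (wrap k (v + (1 - u))) = v" by (rule ballI, rule inv) auto
  qed (use mem in blast)+
  have edge: "{?f v, ?f w} \<in> edges C \<longleftrightarrow> {v, w} \<in> edges C"
    if "v \<in> verts C" "w \<in> verts C" for v w
  proof -
    have vw: "v \<in> {1..k}" "w \<in> {1..k}" using that unfolding verts_C .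
    have plus: "k dvd ?f w - ?f v + t \<longleftrightarrow> k dvd w - v + t" for t
      by (rule dvd_diff_shift[OF diff])
    have minus: "k dvd ?f w - ?f v - t \<longleftrightarrow> k dvd w - v - t" for t
      using plus[of "- t"] by (simp only: add_uminus_conv_diff)
    show ?thesis unfolding edge_iff[OF vw] edge_iff[OF mem mem] plus minus by (rule refl)
  qed
  have lev: "dst (?f x) (?f v) = dst x v" for x v
    by (rule level_cong[OF int_n diff])
  have sub: "{1, wrap k (1 + t)} \<subseteq> verts C" using wrap_in[OF k_pos] n by (auto simp: verts_C)
  have "edge_betweenness C (?f ` {1, wrap k (1 + t)}) = edge_betweenness C {1, wrap k (1 + t)}"
    by (rule edge_betweenness_invariant[OF bij sub edge lev])
  moreover have "?f 1 = u" by (rule wrap_eqI) (use assms in auto)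
  moreover have "?f (wrap k (1 + t)) = wrap k (u + t)" by (rule wrap_wrap) simp
  ultimately show ?thesis by (simp only: image_insert image_empty)
qed

text \<open>Choosing the right endpoint as base, every edge goes forward by a generator, which is
  the form that \<open>sum_edge_betweenness_swap\<close> expects.\<close>

lemma edges_C:
  "edges C = {{u, wrap k (u + 1)} |u. u \<in> verts C} \<union> {{u, wrap k (u + 6 * int n)} |u. u \<in> verts C}"
  (is "_ = ?R")
proof -
  have R: "?R = {{u, wrap k (u + t)} |u t. u \<in> {1..k} \<and> t \<in> {1, 6 * int n}}"
    unfolding verts_C by blast
  have "{u, wrap k (u + t)} \<in> edges C" if "u \<in> {1..k}" "t \<in> {1, 6 * int n}" for u t
    using that wrap_dvd[of k "u + t"] edge_iff[OF that(1) wrap_in[OF k_pos, of "u + t"]]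
    by (auto simp: algebra_simps)
  moreover have "e \<in> ?R" if e: "e \<in> edges C" for e
  proof -
    obtain u v where uv: "e = {u, v}"
      using e by (auto simp: circ_def circulant_def)
    then have e: "e = {u, v}" "u \<in> {1..k}" "v \<in> {1..k}" using e edge_in_verts by blast+
    then obtain t where t: "t \<in> {1, 6 * int n}" "k dvd v - u - t \<or> k dvd v - u + t"
      using \<open>e \<in> edges C\<close> edge_iff by blast
    from t(2) show ?thesis
    proof
      assume "k dvd v - u - t"
      then have "k dvd - (v - u - t)" by (simp only: dvd_minus_iff)
      then have "wrap k (u + t) = v" using e by (intro wrap_eqI) (auto simp: algebra_simps)
      then show ?thesis unfolding R using e t by blast
    next
      assume "k dvd v - u + t"
      then have "wrap k (v + t) = u" using e by (intro wrap_eqI) (auto simp: algebra_simps)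
      then show ?thesis unfolding R using e t by (auto simp: insert_commute)
    qed
  qed
  ultimately show ?thesis unfolding R by blast
qed

text \<open>The involution centred at each source makes the sums over the two kinds equal. By
  translation each sum consists of \<open>k\<close> equal terms, so dividing by \<open>k\<close>
  compares single edges.\<close>

lemma edge_betweenness_classes_eq:
  "edge_betweenness C {1, wrap k (1 + 1)} = edge_betweenness C {1, wrap k (1 + 6 * int n)}"
proof -
  let ?s = "\<lambda>x u. wrap k (x + twist (int n) (u - x))"
  have s_dvd: "k dvd (?s x u - x) - twist (int n) (u - x)" for x u
    using wrap_dvd[of k "x + twist (int n) (u - x)"] by (simp add: algebra_simps)
  \<comment> \<open>Transfers \<open>twist_step\<close> and \<open>twist_step'\<close> from integers
    to vertices; \<open>t\<close> and \<open>t'\<close> are the two generators in either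
    order.\<close>
  have s_step: "?s x (wrap k (u + t)) = wrap k (?s x u + t')"
    if "k dvd twist (int n) (u - x + t) - (twist (int n) (u - x) + t')" for x u t t'
  proof -
    have "k dvd (wrap k (u + t) - x) - (u - x + t)"
      using wrap_dvd[of k "u + t"] by (simp add: algebra_simps)
    from dvd_add[OF twist_cong[OF int_n this] that]
    have "k dvd twist (int n) (wrap k (u + t) - x) - (twist (int n) (u - x) + t')"
      by (simp only: diff_add_cancel add_diff_eq)
    then have "k dvd - (twist (int n) (wrap k (u + t) - x) - (twist (int n) (u - x) + t'))"
      by (simp only: dvd_minus_iff)
    then have "wrap k (?s x u + t') = wrap k (x + twist (int n) (wrap k (u + t) - x))"
      by (intro wrap_wrap) (simp add: algebra_simps)
    then show ?thesis by simp
  qed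
  have lev: "level (int n) (wrap k (u + t) - x) = level (int n) (u - x + t)" for u t x
    using wrap_dvd[of k "u + t"] by (intro level_cong[OF int_n]) (simp add: algebra_simps)
  have "(\<Sum>u\<in>verts C. edge_betweenness C {u, wrap k (u + 1)}) =
      (\<Sum>u\<in>verts C. edge_betweenness C {u, wrap k (u + 6 * int n)})"
  proof (rule sum_edge_betweenness_swap[where s = ?s])
    fix x u assume xu: "x \<in> verts C" "u \<in> verts C"
    show "?s x u \<in> verts C" using wrap_in[OF k_pos] by (simp add: verts_C)
    show "?s x (?s x u) = u"
    proof (rule wrap_eqI)
      show "u \<in> {1..k}" using xu by (simp add: verts_C)
      have "k dvd twist (int n) (?s x u - x) - (u - x)"
        by (rule dvd_diff_trans[OF twist_cong[OF int_n s_dvd] twist_twist[OF int_n]])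
      then show "k dvd x + twist (int n) (?s x u - x) - u" by (simp add: algebra_simps)
    qed
    show "dst x (?s x u) = dst x u"
      using level_cong[OF int_n s_dvd] level_twist[OF int_n] by simp
    show "?s x (wrap k (u + 1)) = wrap k (?s x u + 6 * int n)" if "dst x (wrap k (u + 1)) \<noteq> dst x u"
      by (rule s_step[OF twist_step[OF int_n that[unfolded lev]]])
    show "?s x (wrap k (u + 6 * int n)) = wrap k (?s x u + 1)"
      if "dst x (wrap k (u + 6 * int n)) \<noteq> dst x u"
      by (rule s_step[OF twist_step'[OF int_n that[unfolded lev]]])
  qed (unfold verts_C, (rule wrap_in[OF k_pos])+, rule edges_C[unfolded verts_C])
  moreover have "(\<Sum>u\<in>verts C. edge_betweenness C {u, wrap k (u + t)}) =
      of_int k * edge_betweenness C {1, wrap k (1 + t)}" for t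
  proof -
    have "(\<Sum>u\<in>verts C. edge_betweenness C {u, wrap k (u + t)}) =
        (\<Sum>u\<in>{1..k}. edge_betweenness C {1, wrap k (1 + t)})"
      unfolding verts_C by (rule sum.cong[OF refl edge_betweenness_translate])
    also have "\<dots> = of_int k * edge_betweenness C {1, wrap k (1 + t)}"
      using n by (simp only: sum_constant) simp
    finally show ?thesis .
  qed
  ultimately have "of_int k * edge_betweenness C {1, wrap k (1 + 1)} =
      of_int k * edge_betweenness C {1, wrap k (1 + 6 * int n)}" by (simp only:)
  moreover have "real_of_int k \<noteq> 0" using k_pos by linarith
  ultimately show ?thesis by (simp only: mult_cancel_left) simp
qed

lemma edge_betweenness_C:
  assumes "e \<in> edges C"
  shows "edge_betweenness C e = edge_betweenness C {1, wrap k (1 + 1)}"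
proof -
  obtain u t where "e = {u, wrap k (u + t)}" "u \<in> {1..k}" "t = 1 \<or> t = 6 * int n"
    using assms unfolding edges_C verts_C by blast
  then show ?thesis
    using edge_betweenness_translate edge_betweenness_classes_eq by metis
qed

end

theorem theorem2p4:
  fixes n :: nat
  assumes "n \<ge> 1"
  shows "edge_betweenness_uniform (circulant (18 * n - 3) [1, 6 * n])"
  using edge_betweenness_C[OF assms] unfolding edge_betweenness_uniform_def circ_def[symmetric] by simp

end
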